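(* Let $k\geq 2$ and let $p$ be a prime. Every cyclic $(p,k,1)$-design is generated by a $(p,k,1)$-DDF.
   Context: A $(v,k,\lambda)$-design is a pair $(V,\mathcal{B})$ where $V$ is a set of $v$ points and $\mathcal{B}$ is a collection of $k$-subsets of $V$ called blocks, such that every pair of distinct elements of $V$ is contained in precisely $\lambda$ blocks of $\mathcal{B}$. An automorphism of $(V,\mathcal{B})$ is a permutation of $V$ leaving $\mathcal{B}$ invariant. The design is cyclic if it admits an automorphism consisting of a cycle of length $v$; without loss of generality $V$ is identified with $\mathbb{Z}_v$, the additive group of integers modulo $v$, so that $\mathcal{B}$ is invariant under all translations $B\mapsto B+t$, $t\in\mathbb{Z}_v$. A $(v,k,\lambda)$-cyclic difference family, or $(v,k,\lambda)$-CDF, is a family $\mathcal{F}$ of $k$-subsets (called base blocks) of $\mathbb{Z}_v$ such that the multiset $\{x-y : x,y\in F,\ x\neq y,\ F\in\mathcal{F}\}$ contains every element of $\mathbb{Z}_v\setminus\{0\}$ exactly $\lambda$ times. A $(v,k,\lambda)$-DDF (disjoint difference family) is a $(v,k,\lambda)$-CDF whose base blocks are mutually disjoint. A family $\mathcal{F}$ generates the cyclic $(v,k,\lambda)$-design whose block-multiset is $\{F+t : F\in\mathcal{F},\ t\in\mathbb{Z}_v\}$.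
   Formalization: The hypothesis k < p is added: for k = p the single block Z_p is a cyclic (p,p,1)-design, but no (p,p,1)-CDF exists since p(p-1)|F| = p-1 is impossible; for k > p there are no designs. *)

theory Defs
  imports
    "HOL-Library.Multiset"
    "HOL-Computational_Algebra.Primes"
    "HOL-Combinatorics.Combinatorics"
begin

definition is_design ::
  "nat \<Rightarrow> nat \<Rightarrow> nat \<Rightarrow> 'a set \<Rightarrow> 'a set multiset \<Rightarrow> bool" where
  "is_design v k lam V B \<longleftrightarrow>
     finite V \<and> card V = v \<and>
     (\<forall>b\<in>#B. b \<subseteq> V \<and> card b = k) \<and>
     (\<forall>x\<in>V. \<forall>y\<in>V. x \<noteq> y \<longrightarrow> size {#b \<in># B. x \<in> b \<and> y \<in> b#} = lam)"

definition design_automorphism ::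
  "'a set \<Rightarrow> 'a set multiset \<Rightarrow> ('a \<Rightarrow> 'a) \<Rightarrow> bool" where
  "design_automorphism V B \<sigma> \<longleftrightarrow>
     \<sigma> permutes V \<and> image_mset (\<lambda>b. \<sigma> ` b) B = B"

(* The design (V, B) is cyclic, witnessed by sigma: an automorphism forming a single
   cycle on all of V, that is, a cycle of length v = card V. *)
definition cyclic_design_by ::
  "nat \<Rightarrow> nat \<Rightarrow> nat \<Rightarrow> 'a set \<Rightarrow> 'a set multiset \<Rightarrow> ('a \<Rightarrow> 'a) \<Rightarrow> bool" where
  "cyclic_design_by v k lam V B \<sigma> \<longleftrightarrow>
     is_design v k lam V B \<and> design_automorphism V B \<sigma> \<and> cyclic_on \<sigma> V"

(* The integers modulo v, represented by their least nonnegative residues. *)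
definition Zmod :: "nat \<Rightarrow> int set" where
  "Zmod v = {0..<int v}"

definition translate :: "nat \<Rightarrow> int set \<Rightarrow> int \<Rightarrow> int set" where
  "translate v A t = (\<lambda>x. (x + t) mod int v) ` A"

(* The identification of Z_v with the point set of a cyclic design: x0 is taken as 0 and
   the cyclic automorphism as the translation t -> t + 1.  If the point set is already
   Zmod v, sigma is t -> (t + 1) mod v on it and x0 = 0, this is the identity on Zmod v. *)
definition cyclic_label :: "('a \<Rightarrow> 'a) \<Rightarrow> 'a \<Rightarrow> int \<Rightarrow> 'a" where
  "cyclic_label \<sigma> x0 t = (\<sigma> ^^ nat t) x0"

definition differences :: "nat \<Rightarrow> int set multiset \<Rightarrow> int multiset" where
  "differences v F =
     (\<Sum>A\<in>#F. image_mset (\<lambda>(x, y). (x - y) mod int v)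
                 (mset_set {(x, y). x \<in> A \<and> y \<in> A \<and> x \<noteq> y}))"

definition is_CDF :: "nat \<Rightarrow> nat \<Rightarrow> nat \<Rightarrow> int set multiset \<Rightarrow> bool" where
  "is_CDF v k lam F \<longleftrightarrow>
     (\<forall>A\<in>#F. A \<subseteq> Zmod v \<and> card A = k) \<and>
     (\<forall>d\<in>Zmod v - {0}. count (differences v F) d = lam)"

(* Removing one copy of A compares base blocks by position in the family, so a nonempty
   base block cannot be repeated. *)
definition is_DDF :: "nat \<Rightarrow> nat \<Rightarrow> nat \<Rightarrow> int set multiset \<Rightarrow> bool" where
  "is_DDF v k lam F \<longleftrightarrow>
     is_CDF v k lam F \<and> (\<forall>A\<in>#F. \<forall>A'\<in>#F - {#A#}. A \<inter> A' = {})"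

(* One translate for every pair (F, t), hence with multiplicity. *)
definition generated_blocks :: "nat \<Rightarrow> int set multiset \<Rightarrow> int set multiset" where
  "generated_blocks v F =
     (\<Sum>A\<in>#F. image_mset (translate v A) (mset_set (Zmod v)))"

end

(* Every pair of points lies in one block, so the k(k-1) n differences inside the n base
   blocks are distinct and nonzero, hence n k (k-1) = p - 1.  Translating the base blocks by
   t_1, ..., t_n makes them disjoint iff each t_j - t_i with i < j avoids k^2 residues, that is,
   iff p does not divide the integer prod (t_j - t_i - e), the product running over i < j and the
   forbidden residues e.  With c the least integer such that k^2 <= 2c, pad to 2c forbidden
   residues per pair.  An iterated finite difference of order c(n-1) in each variable only sees
   the leading form of the product, so the forbidden residues may be replaced by
   1-c, ..., c for every pair (Karasev and Petrov's proof of Dyson's identity).  Then a single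
   point of the grid {0, ..., c(n-1)}^n contributes, and its contribution is prime to p
   because c n <= p - 1. *)

theory Submission
  imports Defs "HOL-Number_Theory.Cong"
begin

section \<open>Finite differences of polynomials on a grid\<close>

text \<open>A finite difference of order \<open>d\<close> kills powers below \<open>d\<close>.
  Absorption, \<open>x * (d choose x) = d * ((d - 1) choose (x - 1))\<close>, lowers order and
  exponent together; expanding \<open>(y + 1) ^ m\<close> then produces all exponents up to
  \<open>m\<close>, hence the strong induction.\<close>

lemma alternating_binomial_power_sum:
  fixes e d :: nat
  assumes "e < d"
  shows "(\<Sum>x\<le>d. (-1) ^ x * int (d choose x) * int x ^ e) = 0"
  using assms
proof (induction e arbitrary: d rule: less_induct)
  case (less e)
  show ?case
  proof (cases e)
    case 0
    then show ?thesis using choose_alternating_sum[of d, where 'a=int] less.prems by simp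
  next
    case (Suc m)
    obtain d' where d: "d = Suc d'" using less.prems by (cases d) auto
    \<comment> \<open>The term \<open>x = 0\<close> vanishes because the exponent is positive, so
      the sum shifts to \<open>x = Suc y\<close>.\<close>
    have "(\<Sum>x\<le>d. (-1) ^ x * int (d choose x) * int x ^ e)
        = (\<Sum>y\<le>d'. (-1) ^ Suc y * int (Suc d' choose Suc y) * int (Suc y) ^ Suc m)"
      unfolding d Suc sum.atMost_Suc_shift by simp
    also have "\<dots> = (\<Sum>y\<le>d'. - int (Suc d') * ((-1) ^ y * int (d' choose y) * (int y + 1) ^ m))"
    proof (rule sum.cong)
      fix y
      have "int (Suc y) * int (Suc d' choose Suc y) = int (Suc d') * int (d' choose y)"
        by (metis Suc_times_binomial of_nat_mult)
      moreover have "(-1) ^ Suc y * int (Suc d' choose Suc y) * int (Suc y) ^ Suc m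
          = - ((-1) ^ y * (int (Suc y) * int (Suc d' choose Suc y)) * (int y + 1) ^ m)"
        by (simp del: binomial_Suc_Suc add: mult_ac add.commute)
      ultimately show "(-1) ^ Suc y * int (Suc d' choose Suc y) * int (Suc y) ^ Suc m
          = - int (Suc d') * ((-1) ^ y * int (d' choose y) * (int y + 1) ^ m)"
        by (simp only: mult_ac mult_minus_left)
    qed simp
    also have "\<dots> = - int (Suc d') *
        (\<Sum>y\<le>d'. \<Sum>l\<le>m. int (m choose l) * ((-1) ^ y * int (d' choose y) * int y ^ l))"
      by (simp add: sum_distrib_left binomial_ring mult_ac)
    also have "\<dots> = - int (Suc d') *
        (\<Sum>l\<le>m. int (m choose l) * (\<Sum>y\<le>d'. (-1) ^ y * int (d' choose y) * int y ^ l))"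
      by (subst sum.swap) (simp add: sum_distrib_left)
    also have "\<dots> = 0"
    proof -
      have "(\<Sum>y\<le>d'. (-1) ^ y * int (d' choose y) * int y ^ l) = 0" if "l \<le> m" for l
        using less.IH[of l d'] less.prems that Suc d by simp
      then show ?thesis by simp
    qed
    finally show ?thesis .
  qed
qed

text \<open>Up to sign, the mixed finite difference at the origin, of order \<open>d i\<close> in
  the variable \<open>i\<close>.\<close>

definition grid_diff :: "'a set \<Rightarrow> ('a \<Rightarrow> nat) \<Rightarrow> (('a \<Rightarrow> nat) \<Rightarrow> int) \<Rightarrow> int" where
  "grid_diff I d f =
     (\<Sum>x\<in>Pi\<^sub>E I (\<lambda>i. {..d i}). (\<Prod>i\<in>I. (-1) ^ x i * int (d i choose x i)) * f x)"

lemma grid_diff_add: "grid_diff I d (\<lambda>x. f x + g x) = grid_diff I d f + grid_diff I d g"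
  by (simp add: grid_diff_def distrib_left sum.distrib)

lemma grid_diff_diff: "grid_diff I d (\<lambda>x. f x - g x) = grid_diff I d f - grid_diff I d g"
  by (simp add: grid_diff_def right_diff_distrib sum_subtractf)

lemma grid_diff_cmult: "grid_diff I d (\<lambda>x. c * f x) = c * grid_diff I d f"
  by (simp add: grid_diff_def sum_distrib_left mult_ac)

text \<open>The sum factors into one-variable sums, and some exponent is smaller than the order of
  the difference in its variable.\<close>

lemma grid_diff_monomial:
  assumes "finite I" and "sum e I < sum d I"
  shows "grid_diff I d (\<lambda>x. \<Prod>i\<in>I. int (x i) ^ e i) = 0"
proof -
  obtain i where i: "i \<in> I" "e i < d i"
    using assms(2) by (meson not_le sum_mono)
  have "grid_diff I d (\<lambda>x. \<Prod>i\<in>I. int (x i) ^ e i)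
      = (\<Sum>x\<in>Pi\<^sub>E I (\<lambda>i. {..d i}). \<Prod>i\<in>I. (-1) ^ x i * int (d i choose x i) * int (x i) ^ e i)"
    by (simp add: grid_diff_def prod.distrib)
  also have "\<dots> = (\<Prod>i\<in>I. \<Sum>y\<le>d i. (-1) ^ y * int (d i choose y) * int y ^ e i)"
    by (rule prod_sum_PiE[symmetric]) (use assms in auto)
  also have "\<dots> = 0"
    using i assms(1) alternating_binomial_power_sum[OF i(2)] by (intro prod_zero) auto
  finally show ?thesis .
qed

lemma monomial_mult_var:
  fixes x :: "'a \<Rightarrow> nat"
  assumes "finite I" and "u \<in> I"
  shows "(\<Prod>i\<in>I. int (x i) ^ (e(u := Suc (e u))) i) = int (x u) * (\<Prod>i\<in>I. int (x i) ^ e i)"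
proof -
  have "(\<Prod>i\<in>I - {u}. int (x i) ^ (e(u := Suc (e u))) i) = (\<Prod>i\<in>I - {u}. int (x i) ^ e i)"
    by (rule prod.cong) auto
  then show ?thesis
    using assms by (simp add: prod.remove[of I u])
qed

lemma sum_fun_upd_Suc:
  assumes "finite I" and "u \<in> I"
  shows "sum (e(u := Suc (e u))) I = Suc (sum e I)"
proof -
  have "sum (e(u := Suc (e u))) (I - {u}) = sum e (I - {u})"
    by (rule sum.cong) auto
  then show ?thesis
    using assms by (simp add: sum.remove[of I u])
qed

text \<open>Expansion step for the two inductions below: a variable is absorbed into the monomial,
  while the constant \<open>c\<close> loses one degree. \<open>f\<close> stands for the product of
  the remaining factors.\<close>

lemma grid_diff_linear_factor:
  assumes "finite I" "u \<in> I" "v \<in> I"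
  shows "grid_diff I d (\<lambda>x. (int (x u) - int (x v) + c) * f x * (\<Prod>i\<in>I. int (x i) ^ e i))
       = grid_diff I d (\<lambda>x. f x * (\<Prod>i\<in>I. int (x i) ^ (e(u := Suc (e u))) i))
         - grid_diff I d (\<lambda>x. f x * (\<Prod>i\<in>I. int (x i) ^ (e(v := Suc (e v))) i))
         + c * grid_diff I d (\<lambda>x. f x * (\<Prod>i\<in>I. int (x i) ^ e i))"
  unfolding monomial_mult_var[OF assms(1,2)] monomial_mult_var[OF assms(1,3)]
    grid_diff_cmult[symmetric] grid_diff_add[symmetric] grid_diff_diff[symmetric]
  by (rule arg_cong[where f = "grid_diff I d"]) (simp add: fun_eq_iff algebra_simps)

text \<open>The monomial is carried along for the induction on \<open>T\<close>: each expansion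
  trades one factor for at most one degree of the monomial.\<close>

lemma grid_diff_low_degree:
  assumes "finite T" "finite I" "u ` T \<subseteq> I" "v ` T \<subseteq> I" "card T + sum e I < sum d I"
  shows "grid_diff I d (\<lambda>x. (\<Prod>\<tau>\<in>T. int (x (u \<tau>)) - int (x (v \<tau>)) + c \<tau>)
           * (\<Prod>i\<in>I. int (x i) ^ e i)) = 0"
  using assms
proof (induction T arbitrary: e rule: finite_induct)
  case empty
  then show ?case using grid_diff_monomial[of I e d] by simp
next
  case (insert t T)
  have "u t \<in> I" "v t \<in> I" using insert.prems by auto
  with insert show ?case
    by (simp add: grid_diff_linear_factor sum_fun_upd_Suc del: fun_upd_apply)
qed

text \<open>The two sides differ only in terms that pick a constant from some factor; these have
  degree below \<open>sum d I\<close> and vanish by \<open>grid_diff_low_degree\<close>.\<close>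

lemma grid_diff_leading_form:
  assumes "finite T" "finite I" "u ` T \<subseteq> I" "v ` T \<subseteq> I" "card T + sum e I \<le> sum d I"
  shows "grid_diff I d (\<lambda>x. (\<Prod>\<tau>\<in>T. int (x (u \<tau>)) - int (x (v \<tau>)) + c \<tau>)
           * (\<Prod>i\<in>I. int (x i) ^ e i))
       = grid_diff I d (\<lambda>x. (\<Prod>\<tau>\<in>T. int (x (u \<tau>)) - int (x (v \<tau>)) + c' \<tau>)
           * (\<Prod>i\<in>I. int (x i) ^ e i))"
  using assms
proof (induction T arbitrary: e rule: finite_induct)
  case empty
  then show ?case by simp
next
  case (insert t T)
  have "u t \<in> I" "v t \<in> I" using insert.prems by auto
  with insert show ?case
    by (simp add: grid_diff_linear_factor sum_fun_upd_Suc grid_diff_low_degree del: fun_upd_apply)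
qed

section \<open>Avoiding forbidden differences modulo a prime\<close>

text \<open>Cut \<open>0..c * n - 1\<close> into \<open>n\<close> windows of length
  \<open>c\<close>. Two values in one window would be too close, so each window holds exactly one;
  the spacing then fixes its place in the window, and the asymmetry of \<open>sep\<close> fixes the
  order of the indices.\<close>

lemma spaced_descending_unique:
  fixes x :: "nat \<Rightarrow> nat"
  assumes "0 < c"
    and ub: "\<And>i. i < n \<Longrightarrow> x i \<le> c * (n - 1)"
    and sep: "\<And>i j. i < j \<Longrightarrow> j < n \<Longrightarrow> x j + c \<le> x i \<or> x i + c < x j"
    and "i < n"
  shows "x i = c * (n - Suc i)"
proof -
  define q where "q = (\<lambda>i. x i div c)"
  have q_lower: "c * q i \<le> x i" and q_upper: "x i < c * q i + c" for i
    using \<open>0 < c\<close> dividend_less_times_div[of c "x i"] by (simp_all add: q_def)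
  have q_neq: "q i \<noteq> q j" if "i < j" "j < n" for i j
    using sep[OF that] q_lower[of i] q_lower[of j] q_upper[of i] q_upper[of j] by (auto; linarith)
  have "inj_on q {..<n}"
    by (intro inj_onI) (metis q_neq lessThan_iff linorder_neqE_nat)
  moreover have "q ` {..<n} \<subseteq> {..<n}"
  proof clarsimp
    fix i assume "i < n"
    then have "c * q i \<le> c * (n - 1)" using ub q_lower le_trans by blast
    then show "q i < n" using \<open>0 < c\<close> \<open>i < n\<close> by simp
  qed
  ultimately have bij: "bij_betw q {..<n} {..<n}"
    by (simp add: bij_betw_def endo_inj_surj)
  \<comment> \<open>Induction on the windows from the top. The top one meets the allowed range only
    in its left end. If the value above sits at a left end, the next lower one must as well, and the
    strict case of \<open>sep\<close> forbids it a smaller index. The conjunct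
    \<open>m \<le> i\<close> records this growth of the indices.\<close>
  have top: "x i = c * q i \<and> m \<le> i" if "m < n" "i < n" "q i = n - Suc m" for m i
    using that
  proof (induction m arbitrary: i)
    case 0
    then show ?case using ub[of i] q_lower[of i] by simp
  next
    case (Suc m)
    obtain b where b: "b < n" "q b = n - Suc m"
      using bij Suc.prems(1) unfolding bij_betw_def
      by (metis diff_less imageE lessThan_iff less_imp_Suc_add zero_less_Suc)
    have xb: "x b = c * q b" "m \<le> b" using Suc.IH[OF _ b] Suc.prems by auto
    have "q b = Suc (q i)" using b Suc.prems by simp
    with xb have xb': "x b = c * q i + c" by simp
    have "i \<noteq> b" using \<open>q b = Suc (q i)\<close> by auto
    moreover have "\<not> i < b"
      using sep[of i b] b xb' q_lower[of i] q_upper[of i] by auto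
    ultimately have "b < i" by simp
    then show ?case
      using sep[of b i] Suc.prems xb xb' q_lower[of i] q_upper[of i] by auto
  qed
  have ge: "n - Suc i \<le> q i" and eq: "x i = c * q i" if "i < n" for i
  proof -
    have "q i < n" using bij that by (auto simp: bij_betw_def)
    then show "n - Suc i \<le> q i" "x i = c * q i"
      using top[of "n - Suc (q i)" i] that by auto
  qed
  \<comment> \<open>Both \<open>n - Suc i\<close> and \<open>q i\<close> run through
    \<open>0..n - 1\<close>, so the sums agree and the pointwise inequality \<open>ge\<close> is an
    equality.\<close>
  have "(\<Sum>i<n. n - Suc i) = (\<Sum>i<n. q i)"
    using sum.nat_diff_reindex[of "\<lambda>i. i" n] sum.reindex_bij_betw[OF bij, of "\<lambda>i. i"] by simp
  then have "n - Suc i = q i"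
    by (rule sum_mono_inv) (use ge \<open>i < n\<close> in auto)
  then show ?thesis using eq \<open>i < n\<close> by simp
qed

text \<open>Pads a set of forbidden residues to a family indexed by \<open>S\<close>: indices
  outside the image of the injection \<open>g\<close> get arbitrary values, which can only forbid
  more.\<close>

lemma exists_covering_map:
  assumes "finite E" "finite S" "card E \<le> card S"
  shows "\<exists>h. E \<subseteq> h ` S"
proof -
  obtain g where g: "g ` E \<subseteq> S" "inj_on g E"
    using card_le_inj[OF assms] by blast
  have "E \<subseteq> inv_into E g ` S"
    using g by (force intro: rev_image_eqI simp: inv_into_f_f)
  then show ?thesis by blast
qed

lemma prime_not_dvd_binomial:
  assumes "prime (p::nat)" "d < p" "k \<le> d"
  shows "\<not> p dvd d choose k"
proof
  assume "p dvd d choose k"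
  then have "p dvd fact d"
    using binomial_fact_lemma[OF assms(3)] by (metis dvd_mult)
  then show False using assms by (simp add: prime_dvd_fact_iff)
qed

text \<open>Otherwise each grid point, read as a choice of \<open>t\<close>, makes \<open>p\<close>
  divide the product \<open>f\<close>, so \<open>p\<close> divides the grid difference of
  \<open>f\<close>. This equals the grid difference of \<open>g\<close>, whose one surviving term is
  prime to \<open>p\<close>.\<close>

lemma avoid_differences:
  fixes E :: "nat \<Rightarrow> nat \<Rightarrow> int set" and p c n :: nat
  assumes p: "prime p" and "0 < c" "c * n < p"
    and E: "\<And>i j. i < j \<Longrightarrow> j < n \<Longrightarrow> finite (E i j) \<and> card (E i j) \<le> 2 * c"
  shows "\<exists>t. \<forall>i j. i < j \<longrightarrow> j < n \<longrightarrow> (\<forall>e\<in>E i j. \<not> int p dvd t j - t i - e)"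
proof (rule ccontr)
  assume "\<not> ?thesis"
  then have bad: "\<exists>i j e. i < j \<and> j < n \<and> e \<in> E i j \<and> int p dvd t j - t i - e" for t
    by blast
  \<comment> \<open>Exactly \<open>2 * c\<close> integers, off-centre on purpose: avoiding them
    means \<open>x j - x i \<le> - c\<close> or \<open>x j - x i > c\<close>, the asymmetric
    separation of \<open>spaced_descending_unique\<close>.\<close>
  define S where "S = {1 - int c..int c}"
  have "\<exists>h. E i j \<subseteq> h ` S" if "i < j" "j < n" for i j
    using E[OF that] by (intro exists_covering_map) (auto simp: S_def)
  then obtain h where h: "\<And>i j. i < j \<Longrightarrow> j < n \<Longrightarrow> E i j \<subseteq> h i j ` S"
    by metis
  \<comment> \<open>Pairs are stored with the larger index first: \<open>fst (fst \<tau>)\<close> is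
    \<open>j\<close> and \<open>snd (fst \<tau>)\<close> is \<open>i\<close>.\<close>
  define P where "P = (SIGMA j:{..<n}. {..<j})"
  define T where "T = P \<times> S"
  \<comment> \<open>With this order, \<open>sum d {..<n} = c * n * (n - 1)\<close> is exactly the
    number of factors, the boundary case of \<open>grid_diff_leading_form\<close>.\<close>
  define d where "d = (\<lambda>i::nat. c * (n - 1))"
  define f where "f = (\<lambda>x. \<Prod>\<tau>\<in>T. int (x (fst (fst \<tau>))) - int (x (snd (fst \<tau>)))
                           + - h (snd (fst \<tau>)) (fst (fst \<tau>)) (snd \<tau>))"
  define g where "g = (\<lambda>x. \<Prod>\<tau>\<in>T. int (x (fst (fst \<tau>))) - int (x (snd (fst \<tau>))) + - snd \<tau>)"
  have finT: "finite T" by (simp add: T_def P_def S_def)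
  have "card P * 2 = n * (n - 1)"
  proof -
    have "card P = (\<Sum>j<n. j)" by (simp add: P_def)
    moreover have "(\<Sum>j<n. j) * 2 = n * (n - 1)"
    proof (induction n)
      case (Suc m)
      then show ?case by (cases m) (auto simp: algebra_simps)
    qed simp
    ultimately show ?thesis by simp
  qed
  moreover have "card S = 2 * c" by (simp add: S_def)
  ultimately have "card T = sum d {..<n}"
    by (simp add: T_def d_def card_cartesian_product)
  then have "grid_diff {..<n} d f = grid_diff {..<n} d g"
    using grid_diff_leading_form[OF finT finite_lessThan, of "\<lambda>\<tau>. fst (fst \<tau>)" n
        "\<lambda>\<tau>. snd (fst \<tau>)" "\<lambda>_. 0" d
        "\<lambda>\<tau>. - h (snd (fst \<tau>)) (fst (fst \<tau>)) (snd \<tau>)" "\<lambda>\<tau>. - snd \<tau>"]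
    by (auto simp: f_def g_def T_def P_def image_subset_iff)
  moreover have "int p dvd grid_diff {..<n} d f"
    unfolding grid_diff_def
  proof (intro dvd_sum dvd_mult)
    fix x
    obtain i j e where ije: "i < j" "j < n" "e \<in> E i j" "int p dvd int (x j) - int (x i) - e"
      using bad[of "\<lambda>i. int (x i)"] by blast
    obtain s where s: "s \<in> S" "e = h i j s" using h ije by blast
    have "((j, i), s) \<in> T" using ije s by (simp add: T_def P_def)
    then show "int p dvd f x"
      unfolding f_def using ije s by (intro dvd_trans[OF _ dvd_prodI[OF finT]]) auto
  qed
  moreover have "\<not> int p dvd grid_diff {..<n} d g"
  proof -
    \<comment> \<open>The descending progression \<open>c * (n - 1), ..., c, 0\<close> is the only
      grid point where \<open>g\<close> can be nonzero.\<close>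
    define y where "y = restrict (\<lambda>i. c * (n - Suc i)) {..<n}"
    define w where "w = (\<lambda>x. \<Prod>i<n. (-1) ^ x i * int (d i choose x i))"
    have y: "y \<in> Pi\<^sub>E {..<n} (\<lambda>i. {..d i})"
      by (auto simp: y_def d_def)
    have "g x = 0" if x: "x \<in> Pi\<^sub>E {..<n} (\<lambda>i. {..d i})" "x \<noteq> y" for x
    proof (rule ccontr)
      assume "g x \<noteq> 0"
      then have nz: "int (x j) - int (x i) \<noteq> s" if "i < j" "j < n" "s \<in> S" for i j s
        using that finT by (force simp: g_def T_def P_def)
      have "x j + c \<le> x i \<or> x i + c < x j" if "i < j" "j < n" for i j
        using nz[OF that, of "int (x j) - int (x i)"] unfolding S_def atLeastAtMost_iff by linarith
      moreover have "x i \<le> c * (n - 1)" if "i < n" for i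
        using x(1) that by (auto simp: d_def PiE_iff)
      ultimately have "x i = y i" if "i < n" for i
        using spaced_descending_unique[OF \<open>0 < c\<close>, of n x i] that by (auto simp: y_def)
      then show False using x y by (metis PiE_ext lessThan_iff)
    qed
    then have "grid_diff {..<n} d g = (\<Sum>x\<in>{y}. w x * g x)"
      unfolding grid_diff_def w_def using y
      by (intro sum.mono_neutral_right) (auto intro: finite_PiE)
    moreover have "\<not> int p dvd w y"
    proof -
      have "\<not> int p dvd (-1) ^ y i * int (d i choose y i)" if "i < n" for i
      proof -
        have "d i < p" using \<open>c * n < p\<close> by (simp add: d_def diff_mult_distrib2)
        moreover have "y i \<le> d i" using y that by auto
        ultimately show ?thesis using prime_not_dvd_binomial[OF p]
          by (simp add: minus_one_power_iff)
      qed
      then show ?thesis using p by (simp add: w_def prime_dvd_prod_iff)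
    qed
    moreover have "\<not> int p dvd g y"
    proof -
      \<comment> \<open>The negated factor is \<open>c * (j - i) + s\<close> with
        \<open>c \<le> c * (j - i) \<le> c * (n - 1)\<close> and
        \<open>1 - c \<le> s \<le> c\<close>, so it lies between \<open>1\<close> and
        \<open>c * n < p\<close>.\<close>
      have "\<not> int p dvd int (y j) - int (y i) + - s" if "i < j" "j < n" "s \<in> S" for i j s
      proof
        assume "int p dvd int (y j) - int (y i) + - s"
        then have dvd: "int p dvd int (y i) - int (y j) + s"
          by (metis add_diff_eq diff_minus_eq_add dvd_minus_iff minus_diff_eq uminus_add_conv_diff add.commute)
        have "n - Suc i = (n - Suc j) + (j - i)" using that by simp
        moreover have "y i = c * (n - Suc i)" "y j = c * (n - Suc j)" using that by (auto simp: y_def)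
        ultimately have yi: "y i = y j + c * (j - i)" by (simp only: distrib_left)
        have "c * 1 \<le> c * (j - i)" and "c * (j - i) + c * 1 \<le> c * n"
          unfolding distrib_left[symmetric] using that by (intro mult_le_mono2; simp)+
        then obtain m where "y i = y j + m" "c \<le> m" "m + c \<le> c * n"
          using yi by (metis mult.right_neutral)
        then have "0 < int (y i) - int (y j) + s" "int (y i) - int (y j) + s < int p"
          using \<open>s \<in> S\<close> \<open>c * n < p\<close> unfolding S_def by auto
        then show False using dvd zdvd_not_zless by blast
      qed
      then show ?thesis using p finT by (auto simp: g_def prime_dvd_prod_iff T_def P_def)
    qed
    ultimately show ?thesis using p by (simp add: prime_dvd_mult_iff)
  qed
  ultimately show False by simp
qed

section \<open>Translates of sets of residues\<close>

lemma translate_subset_Zmod: "0 < v \<Longrightarrow> translate v A t \<subseteq> Zmod v"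
  by (auto simp: translate_def Zmod_def)

lemma translate_translate: "translate v (translate v A s) t = translate v A (s + t)"
  by (simp add: translate_def image_image mod_simps add.assoc)

lemma translate_cong: "s mod int v = t mod int v \<Longrightarrow> translate v A s = translate v A t"
  unfolding translate_def by (intro image_cong refl) (metis mod_add_right_eq)

lemma translate_0: "A \<subseteq> Zmod v \<Longrightarrow> translate v A 0 = A"
  by (force simp: translate_def Zmod_def)

lemma translate_eq_iff:
  assumes "A \<subseteq> Zmod v" "A' \<subseteq> Zmod v"
  shows "translate v A s = translate v A' t \<longleftrightarrow> A = translate v A' (t - s)"
proof
  assume "translate v A s = translate v A' t"
  then have "translate v (translate v A s) (- s) = translate v (translate v A' t) (- s)" by simp
  then show "A = translate v A' (t - s)" using assms(1) by (simp add: translate_translate translate_0)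
qed (simp add: translate_translate)

lemma inj_on_translate:
  assumes "A \<subseteq> Zmod v"
  shows "inj_on (\<lambda>x. (x + t) mod int v) A"
proof (rule inj_onI)
  fix x y assume "x \<in> A" "y \<in> A" "(x + t) mod int v = (y + t) mod int v"
  then have "x mod int v = y mod int v"
    by (metis add_diff_cancel_right' mod_diff_left_eq)
  then show "x = y" using assms \<open>x \<in> A\<close> \<open>y \<in> A\<close> by (auto simp: Zmod_def subset_iff)
qed

lemma finite_Zmod [simp]: "finite (Zmod v)"
  by (simp add: Zmod_def)

text \<open>Reduces the computation of \<open>differences\<close> and
  \<open>generated_blocks\<close> to showing that one map on pairs is injective and finding its
  image.\<close>

lemma sum_image_mset_mset_set:
  assumes "finite R" "\<And>A. A \<in> R \<Longrightarrow> finite (X A)"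
  shows "(\<Sum>A\<in>#mset_set R. image_mset (g A) (mset_set (X A)))
       = image_mset (\<lambda>(A, x). g A x) (mset_set (Sigma R X))"
  using assms
proof (induction R rule: finite_induct)
  case (insert a R)
  have "Sigma (insert a R) X = Pair a ` X a \<union> Sigma R X" by auto
  moreover have "mset_set (Pair a ` X a \<union> Sigma R X) = mset_set (Pair a ` X a) + mset_set (Sigma R X)"
    using insert by (intro mset_set_Union) (auto intro!: finite_SigmaI)
  moreover have "mset_set (Pair a ` X a) = image_mset (Pair a) (mset_set (X a))"
    by (intro image_mset_mset_set[symmetric]) (simp add: inj_on_def)
  ultimately show ?case
    using insert by (simp add: image_mset.compositionality comp_def)
qed simp

section \<open>Base blocks of a cyclic design with one block through each pair\<close>

text \<open>A cyclic \<open>(p, k, 1)\<close>-design on \<open>Zmod p\<close>, with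
  \<open>lam = 1\<close> split into existence and uniqueness. A set of blocks suffices, since a
  repeated block would put a pair into two blocks. The bounds on \<open>k\<close> make it invertible
  modulo \<open>p\<close>, so that every translation orbit has full length; \<open>k < p\<close>
  excludes the whole point set as a block.\<close>

locale cyclic_linear_space =
  fixes p k :: nat and D :: "int set set"
  assumes prime: "prime p" and k_ge: "2 \<le> k" and k_less: "k < p"
    and block_subset: "b \<in> D \<Longrightarrow> b \<subseteq> Zmod p"
    and block_card: "b \<in> D \<Longrightarrow> card b = k"
    and ex_block: "x \<in> Zmod p \<Longrightarrow> y \<in> Zmod p \<Longrightarrow> x \<noteq> y \<Longrightarrow> \<exists>b\<in>D. x \<in> b \<and> y \<in> b"
    and block_unique: "b \<in> D \<Longrightarrow> b' \<in> D \<Longrightarrow> x \<noteq> y \<Longrightarrow> x \<in> b \<Longrightarrow> y \<in> b \<Longrightarrow> x \<in> b' \<Longrightarrow> y \<in> b' \<Longrightarrow> b = b'"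
    and translate_1: "b \<in> D \<Longrightarrow> translate p b 1 \<in> D"
begin

lemma p_pos: "0 < p"
  using prime by (simp add: prime_gt_0_nat)

lemma finite_D: "finite D"
  by (rule finite_subset[of _ "Pow (Zmod p)"]) (use block_subset in auto)

lemma finite_block: "b \<in> D \<Longrightarrow> finite b"
  using block_subset finite_Zmod finite_subset by blast

lemma translate_closed:
  assumes "b \<in> D"
  shows "translate p b t \<in> D"
proof -
  have *: "translate p b (int m) \<in> D" for m
  proof (induction m)
    case 0
    then show ?case using assms block_subset translate_0 by simp
  next
    case (Suc m)
    then show ?case using translate_1[OF Suc] by (simp add: translate_translate add.commute)
  qed
  have "translate p b t = translate p b (int (nat (t mod int p)))"
    using p_pos by (intro translate_cong) simp
  then show ?thesis using * by (simp only:)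
qed

text \<open>Comparing the sums of the elements of both translates gives \<open>k * s = k * t\<close> modulo \<open>p\<close>.\<close>
lemma translate_eq_imp_mod_eq:
  assumes "b \<in> D" "translate p b s = translate p b t"
  shows "s mod int p = t mod int p"
proof -
  have "[\<Sum>(translate p b u) = \<Sum>b + int k * u] (mod int p)" for u
  proof -
    have "\<Sum>(translate p b u) = (\<Sum>x\<in>b. (x + u) mod int p)"
      unfolding translate_def
      using inj_on_translate[OF block_subset[OF assms(1)]] by (simp add: sum.reindex)
    also have "[\<dots> = (\<Sum>x\<in>b. x + u)] (mod int p)"
      by (intro cong_sum) (simp add: cong_def)
    finally show ?thesis
      using block_card[OF assms(1)] by (simp add: sum.distrib)
  qed
  from this[of s] this[of t] assms(2)
  have "[\<Sum>b + int k * s = \<Sum>b + int k * t] (mod int p)"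
    by (metis cong_sym cong_trans)
  then have "[int k * s = int k * t] (mod int p)"
    by (simp add: cong_add_lcancel)
  moreover have "coprime (int k) (int p)"
    using prime k_ge k_less
    by (metis coprime_commute coprime_int_iff dvd_imp_le not_le not_less_eq_eq numeral_2_eq_2
        prime_imp_coprime zero_less_Suc le_trans Suc_le_eq)
  ultimately have "[s = t] (mod int p)"
    by (metis cong_mult_lcancel coprime_int_iff)
  then show ?thesis by (simp add: cong_def)
qed

text \<open>A system of base blocks: one representative per translation orbit on
  \<open>D\<close>.\<close>

definition transversal :: "int set set \<Rightarrow> bool" where
  "transversal R \<longleftrightarrow> R \<subseteq> D \<and> (\<forall>b\<in>D. \<exists>A\<in>R. \<exists>t. b = translate p A t) \<and>
     (\<forall>A\<in>R. \<forall>A'\<in>R. \<forall>t. A = translate p A' t \<longrightarrow> A = A')"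

lemma ex_transversal: "\<exists>R. transversal R"
proof
  \<comment> \<open>The choice depends only on the orbit: blocks of one orbit have the same
    translates, so \<open>SOME\<close> is applied to equal predicates.\<close>
  define rep where "rep = (\<lambda>b. SOME c. \<exists>t. c = translate p b t)"
  have rep: "\<exists>t. rep b = translate p b t" for b
    unfolding rep_def by (rule someI_ex) blast
  have rep_eq: "rep (translate p b s) = rep b" if "b \<in> D" for b s
  proof -
    have "(\<exists>t. c = translate p (translate p b s) t) \<longleftrightarrow> (\<exists>t. c = translate p b t)" for c
      by (metis translate_translate add.commute diff_add_cancel)
    then show ?thesis by (simp add: rep_def)
  qed
  have "\<exists>t. b = translate p (rep b) t" if "b \<in> D" for b
  proof -
    obtain t where "rep b = translate p b t" using rep by blast
    then have "b = translate p (rep b) (- t)"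
      using block_subset[OF that] by (simp add: translate_translate translate_0)
    then show ?thesis by blast
  qed
  moreover have "rep b = rep b'" if "b \<in> D" "b' \<in> D" "rep b = translate p (rep b') t" for b b' t
  proof -
    obtain s s' where "rep b = translate p b s" "rep b' = translate p b' s'" using rep by metis
    then have "translate p b s = translate p b' (s' + t)" using that by (simp add: translate_translate)
    then show ?thesis using rep_eq that by metis
  qed
  ultimately show "transversal (rep ` D)"
    unfolding transversal_def
  proof (intro conjI ballI allI impI)
    show "rep ` D \<subseteq> D"
    proof clarify
      fix b assume "b \<in> D"
      obtain t where "rep b = translate p b t" using rep by blast
      then show "rep b \<in> D" using translate_closed \<open>b \<in> D\<close> by simp
    qed
  qed blast+
qed

context
  fixes R
  assumes R: "transversal R"
begin

lemma finite_transversal: "finite R"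
  using R finite_D finite_subset by (auto simp: transversal_def)

text \<open>Different representatives lie in different orbits, and every orbit has full length
  \<open>p\<close>.\<close>

lemma transversal_translate_eq:
  assumes "A \<in> R" "A' \<in> R" "translate p A s = translate p A' t"
  shows "A = A' \<and> s mod int p = t mod int p"
proof -
  have D: "A \<in> D" "A' \<in> D" using R assms by (auto simp: transversal_def)
  then have "A = translate p A' (t - s)" using assms(3) by (simp add: translate_eq_iff block_subset)
  then have "A = A'" using R assms by (auto simp: transversal_def)
  then show ?thesis using translate_eq_imp_mod_eq D assms(3) by blast
qed

text \<open>Translate both pairs so that \<open>y\<close> and \<open>y'\<close> go to
  \<open>0\<close>. The two blocks then share \<open>0\<close> and the common nonzero difference, so
  they coincide, and equal translates of base blocks come from equal blocks and shifts.\<close>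

lemma transversal_difference_unique:
  assumes A: "A \<in> R" "x \<in> A" "y \<in> A" "x \<noteq> y"
    and A': "A' \<in> R" "x' \<in> A'" "y' \<in> A'"
    and eq: "(x - y) mod int p = (x' - y') mod int p"
  shows "A = A' \<and> x = x' \<and> y = y'"
proof -
  have D: "A \<in> D" "A' \<in> D" using R A A' by (auto simp: transversal_def)
  have bounds: "0 \<le> x \<and> x < int p" "0 \<le> y \<and> y < int p" "0 \<le> x' \<and> x' < int p" "0 \<le> y' \<and> y' < int p"
    using block_subset[OF D(1)] block_subset[OF D(2)] A A' by (auto simp: Zmod_def)
  have ne: "(x - y) mod int p \<noteq> 0"
  proof
    assume "(x - y) mod int p = 0"
    then have "x mod int p = y mod int p" by (simp add: mod_eq_dvd_iff dvd_eq_mod_eq_0)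
    then show False using bounds \<open>x \<noteq> y\<close> by simp
  qed
  have mem: "0 \<in> translate p B (- v) \<and> (u - v) mod int p \<in> translate p B (- v)"
    if "u \<in> B" "v \<in> B" for B u v
    using that by (force simp: translate_def)
  have "translate p A (- y) = translate p A' (- y')"
    using mem[OF A(2,3)] mem[OF A'(2,3)] ne eq D
    by (intro block_unique[of _ _ 0 "(x - y) mod int p"] translate_closed) auto
  from transversal_translate_eq[OF A(1) A'(1) this]
  have "A = A'" "(- y) mod int p = (- y') mod int p" by auto
  then have "y mod int p = y' mod int p" by (metis minus_minus mod_minus_eq)
  then have "y = y'" using bounds by simp
  have "x mod int p = x' mod int p"
    using eq unfolding \<open>y = y'\<close> by (metis diff_add_cancel mod_add_left_eq)
  then show ?thesis using \<open>A = A'\<close> \<open>y = y'\<close> bounds by simp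
qed

text \<open>The block through \<open>0\<close> and \<open>d\<close> is a translate of a base block,
  and translating back preserves differences.\<close>

lemma transversal_difference_exists:
  assumes "d \<in> Zmod p - {0}"
  shows "\<exists>A\<in>R. \<exists>x\<in>A. \<exists>y\<in>A. x \<noteq> y \<and> d = (x - y) mod int p"
proof -
  obtain b where b: "b \<in> D" "d \<in> b" "0 \<in> b"
    using ex_block[of d 0] assms p_pos by (auto simp: Zmod_def)
  obtain A t where A: "A \<in> R" "b = translate p A t"
    using R b by (auto simp: transversal_def)
  then obtain x y where xy: "x \<in> A" "y \<in> A" "d = (x + t) mod int p" "0 = (y + t) mod int p"
    using b by (auto simp: translate_def)
  have "(x - y) mod int p = ((x + t) mod int p - (y + t) mod int p) mod int p"
    by (simp add: mod_simps)
  then have "(x - y) mod int p = d" unfolding xy(3,4)[symmetric] using assms by (simp add: Zmod_def)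
  then show ?thesis using assms A xy by force
qed

lemma transversal_differences_inj:
  "inj_on (\<lambda>(A, x, y). (x - y) mod int p) (SIGMA A:R. {(x, y). x \<in> A \<and> y \<in> A \<and> x \<noteq> y})"
  (is "inj_on ?f ?S")
proof (rule inj_onI)
  fix u u' assume *: "u \<in> ?S" "u' \<in> ?S" "?f u = ?f u'"
  obtain A x y A' x' y' where "u = (A, x, y)" "u' = (A', x', y')"
    by (metis prod_cases3)
  then show "u = u'" using * transversal_difference_unique[of A x y A' x' y'] by simp
qed

lemma transversal_differences_image:
  "(\<lambda>(A, x, y). (x - y) mod int p) ` (SIGMA A:R. {(x, y). x \<in> A \<and> y \<in> A \<and> x \<noteq> y})
   = Zmod p - {0}"
proof (intro equalityI subsetI)
  fix d assume "d \<in> (\<lambda>(A, x, y). (x - y) mod int p) ` (SIGMA A:R. {(x, y). x \<in> A \<and> y \<in> A \<and> x \<noteq> y})"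
  then obtain A x y where *: "A \<in> R" "x \<in> A" "y \<in> A" "x \<noteq> y" "d = (x - y) mod int p" by auto
  have "d \<noteq> 0"
    using transversal_difference_unique[OF *(1-4) *(1,2,2)] * by auto
  then show "d \<in> Zmod p - {0}" using * p_pos by (auto simp: Zmod_def)
next
  fix d assume "d \<in> Zmod p - {0}"
  then show "d \<in> (\<lambda>(A, x, y). (x - y) mod int p) ` (SIGMA A:R. {(x, y). x \<in> A \<and> y \<in> A \<and> x \<noteq> y})"
    using transversal_difference_exists[of d] by (force simp: image_iff)
qed

lemma finite_distinct_pairs:
  assumes "A \<in> R"
  shows "finite {(x, y). x \<in> A \<and> y \<in> A \<and> x \<noteq> y}"
proof -
  have "finite A" using assms R finite_block by (auto simp: transversal_def)
  then show ?thesis by (auto intro: finite_subset[of _ "A \<times> A"])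
qed

text \<open>Ordered pairs of distinct points inside base blocks correspond bijectively, through
  their differences, to the nonzero residues.\<close>

lemma card_transversal: "card R * (k * (k - 1)) = p - 1"
proof -
  have "card {(x, y). x \<in> A \<and> y \<in> A \<and> x \<noteq> y} = k * (k - 1)" if "A \<in> R" for A
  proof -
    have A: "finite A" "card A = k" using that R finite_block block_card by (auto simp: transversal_def)
    have "{(x, y). x \<in> A \<and> y \<in> A \<and> x \<noteq> y} = (SIGMA x:A. A - {x})" by auto
    then show ?thesis using A by simp
  qed
  then have "card (SIGMA A:R. {(x, y). x \<in> A \<and> y \<in> A \<and> x \<noteq> y}) = card R * (k * (k - 1))"
    using finite_transversal finite_distinct_pairs by simp
  moreover have "card (Zmod p - {0}) = p - 1"
    using p_pos by (simp add: Zmod_def)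
  ultimately show ?thesis
    using card_image[OF transversal_differences_inj] transversal_differences_image by simp
qed

lemma differences_transversal: "differences p (mset_set R) = mset_set (Zmod p - {0})"
proof -
  have "differences p (mset_set R)
      = image_mset (\<lambda>(A, x, y). (x - y) mod int p)
          (mset_set (SIGMA A:R. {(x, y). x \<in> A \<and> y \<in> A \<and> x \<noteq> y}))"
    unfolding differences_def
    by (subst sum_image_mset_mset_set[OF finite_transversal finite_distinct_pairs])
      (simp_all add: case_prod_unfold)
  then show ?thesis
    using image_mset_mset_set[OF transversal_differences_inj] transversal_differences_image by simp
qed

text \<open>Since all orbits have full length, the pairs \<open>(A, t)\<close> produce each block of
  \<open>D\<close> exactly once.\<close>

lemma generated_blocks_transversal: "generated_blocks p (mset_set R) = mset_set D"
proof -
  have "inj_on (\<lambda>(A, t). translate p A t) (R \<times> Zmod p)"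
    using transversal_translate_eq by (intro inj_onI) (fastforce simp: Zmod_def)
  moreover have "(\<lambda>(A, t). translate p A t) ` (R \<times> Zmod p) = D"
  proof (intro equalityI subsetI)
    fix b assume "b \<in> D"
    then obtain A t where A: "A \<in> R" "b = translate p A t"
      using R by (auto simp: transversal_def)
    have "b = translate p A (t mod int p)"
      unfolding A by (intro translate_cong) simp
    moreover have "t mod int p \<in> Zmod p" using p_pos by (simp add: Zmod_def)
    ultimately show "b \<in> (\<lambda>(A, t). translate p A t) ` (R \<times> Zmod p)"
      using \<open>A \<in> R\<close> by (intro image_eqI[where x = "(A, t mod int p)"]) auto
  qed (use R translate_closed in \<open>auto simp: transversal_def\<close>)
  ultimately show ?thesis
    unfolding generated_blocks_def
    using sum_image_mset_mset_set[OF finite_transversal, of "\<lambda>_. Zmod p" "translate p"]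
    by (simp add: image_mset_mset_set)
qed

text \<open>Base blocks may be moved freely within their orbits; the results on differences and
  generated blocks then apply to the moved ones.\<close>

lemma transversal_image_translate: "transversal ((\<lambda>A. translate p A (\<tau> A)) ` R)"
  unfolding transversal_def
proof (intro conjI ballI allI impI)
  show "(\<lambda>A. translate p A (\<tau> A)) ` R \<subseteq> D"
    using R translate_closed by (auto simp: transversal_def)
next
  fix b assume "b \<in> D"
  then obtain A t where A: "A \<in> R" "b = translate p A t"
    using R by (auto simp: transversal_def)
  then have "b = translate p (translate p A (\<tau> A)) (t - \<tau> A)" by (simp add: translate_translate)
  then show "\<exists>A\<in>(\<lambda>A. translate p A (\<tau> A)) ` R. \<exists>t. b = translate p A t" using A by blast
next
  fix A A' t
  assume "A \<in> (\<lambda>A. translate p A (\<tau> A)) ` R" "A' \<in> (\<lambda>A. translate p A (\<tau> A)) ` R"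
    "A = translate p A' t"
  then obtain C C' where C: "C \<in> R" "A = translate p C (\<tau> C)" "C' \<in> R" "A' = translate p C' (\<tau> C')"
    by auto
  with \<open>A = translate p A' t\<close> have "translate p C (\<tau> C) = translate p C' (\<tau> C' + t)"
    by (simp add: translate_translate)
  then have "C = C'" using transversal_translate_eq C by blast
  then show "A = A'" using C by simp
qed

lemma ex_disjoint_translates:
  "\<exists>\<tau>. \<forall>A\<in>R. \<forall>A'\<in>R. A \<noteq> A' \<longrightarrow> translate p A (\<tau> A) \<inter> translate p A' (\<tau> A') = {}"
proof -
  define n where "n = card R"
  obtain e where e: "bij_betw e {..<n} R"
    using ex_bij_betw_nat_finite[OF finite_transversal] by (auto simp: n_def atLeast0LessThan)
  have eD: "e i \<in> D" if "i < n" for i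
    using e that R by (auto simp: bij_betw_def transversal_def)
  define c where "c = (k * k + 1) div 2"
  \<comment> \<open>This is where \<open>2 \<le> k\<close> matters. For \<open>k = 2\<close> both
    sides are \<open>2\<close>, so there is no slack.\<close>
  have "c \<le> k * (k - 1)"
  proof -
    obtain m where "k = Suc (Suc m)" using k_ge by (metis add_2_eq_Suc le_Suc_ex)
    then show ?thesis by (simp add: c_def algebra_simps)
  qed
  then have "c * n \<le> p - 1" using card_transversal by (metis mult.commute mult_le_mono1 n_def)
  then have "c * n < p" using p_pos by simp
  have "0 < c" using k_ge by (simp add: c_def div_greater_zero_iff)
  \<comment> \<open>\<open>x + t i\<close> and \<open>y + t j\<close> agree modulo \<open>p\<close>
    iff \<open>t j - t i\<close> is congruent to \<open>x - y\<close>, so these at most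
    \<open>k * k\<close> values must be avoided.\<close>
  define E where "E = (\<lambda>i j. (\<lambda>(x, y). x - y) ` (e i \<times> e j))"
  have "finite (E i j) \<and> card (E i j) \<le> 2 * c" if "i < j" "j < n" for i j
  proof -
    have D: "e i \<in> D" "e j \<in> D" using eD that by auto
    have "finite (e i \<times> e j)" using D finite_block by simp
    moreover have "card (E i j) \<le> card (e i \<times> e j)"
      unfolding E_def using calculation by (rule card_image_le)
    moreover have "card (e i \<times> e j) = k * k" using D block_card by (simp add: card_cartesian_product)
    moreover have "k * k \<le> 2 * c" by (simp add: c_def)
    ultimately show ?thesis by (simp add: E_def)
  qed
  then obtain t where t: "\<And>i j x. i < j \<Longrightarrow> j < n \<Longrightarrow> x \<in> E i j \<Longrightarrow> \<not> int p dvd t j - t i - x"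
    using avoid_differences[OF prime \<open>0 < c\<close> \<open>c * n < p\<close>, of E] by blast
  have *: "translate p (e i) (t i) \<inter> translate p (e j) (t j) = {}" if "i < j" "j < n" for i j
  proof (rule ccontr)
    assume "translate p (e i) (t i) \<inter> translate p (e j) (t j) \<noteq> {}"
    then obtain x y where xy: "x \<in> e i" "y \<in> e j" "(x + t i) mod int p = (y + t j) mod int p"
      by (auto simp: translate_def)
    then have "int p dvd (y + t j) - (x + t i)" by (metis mod_eq_dvd_iff)
    moreover have "(y + t j) - (x + t i) = t j - t i - (x - y)" by simp
    ultimately show False using t[OF that, of "x - y"] xy by (force simp: E_def)
  qed
  define \<tau> where "\<tau> = (\<lambda>A. t (inv_into {..<n} e A))"
  have "translate p A (\<tau> A) \<inter> translate p A' (\<tau> A') = {}" if "A \<in> R" "A' \<in> R" "A \<noteq> A'" for A A'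
  proof -
    have "R = e ` {..<n}" using e by (simp add: bij_betw_def)
    then obtain i j where ij: "i < n" "j < n" "A = e i" "A' = e j"
      using \<open>A \<in> R\<close> \<open>A' \<in> R\<close> by blast
    then have "\<tau> A = t i" "\<tau> A' = t j"
      using e by (auto simp: \<tau>_def bij_betw_def inv_into_f_f)
    moreover have "i < j \<or> j < i" using ij \<open>A \<noteq> A'\<close> by auto
    ultimately show ?thesis using *[of i j] *[of j i] ij by auto
  qed
  then show ?thesis by blast
qed

end

text \<open>Any transversal already has the right differences and generates \<open>D\<close>, so
  only disjointness has to be arranged, by moving blocks within their orbits.\<close>

lemma ex_DDF: "\<exists>F. is_DDF p k 1 F \<and> generated_blocks p F = mset_set D"
proof -
  obtain R where R: "transversal R" using ex_transversal by blast
  obtain \<tau> where \<tau>: "\<forall>A\<in>R. \<forall>A'\<in>R. A \<noteq> A'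
      \<longrightarrow> translate p A (\<tau> A) \<inter> translate p A' (\<tau> A') = {}"
    using ex_disjoint_translates[OF R] by blast
  define R' where "R' = (\<lambda>A. translate p A (\<tau> A)) ` R"
  have R': "transversal R'" unfolding R'_def by (rule transversal_image_translate[OF R])
  have fin: "finite R'" by (rule finite_transversal[OF R'])
  have "A \<inter> A' = {}" if "A \<in> R'" "A' \<in> R'" "A \<noteq> A'" for A A'
  proof -
    obtain C where C: "A = translate p C (\<tau> C)" "C \<in> R"
      using \<open>A \<in> R'\<close> unfolding R'_def by (rule imageE)
    obtain C' where C': "A' = translate p C' (\<tau> C')" "C' \<in> R"
      using \<open>A' \<in> R'\<close> unfolding R'_def by (rule imageE)
    have "C \<noteq> C'" using \<open>A \<noteq> A'\<close> C C' by auto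
    then show ?thesis using C C' \<tau> by simp
  qed
  \<comment> \<open>\<open>mset_set R'\<close> holds each block once, so removing one copy of
    \<open>A\<close> removes it altogether, and the positional condition of \<open>is_DDF\<close>
    becomes disjointness of distinct blocks.\<close>
  moreover have "A' \<in> R' - {A}" if "A' \<in># mset_set R' - {#A#}" "A \<in> R'" for A A'
  proof -
    have "mset_set (R' - {A}) = mset_set R' - {#A#}"
      using that fin mset_set_Diff[of R' "{A}"] by simp
    with that have "A' \<in># mset_set (R' - {A})" by (simp only:)
    then show ?thesis using fin by simp
  qed
  moreover have "is_CDF p k 1 (mset_set R')"
    unfolding is_CDF_def differences_transversal[OF R']
    using R' fin block_subset block_card by (auto simp: transversal_def)
  ultimately have "is_DDF p k 1 (mset_set R')"
    using fin unfolding is_DDF_def by (metis DiffE elem_mset_set singletonI)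
  then show ?thesis using generated_blocks_transversal[OF R'] by blast
qed

end

section \<open>Transfer to an arbitrary point set\<close>

text \<open>\<open>V\<close> is the orbit of \<open>x0\<close>, listed without repetition up to the
  first return time \<open>funpow_dist1 \<sigma> x0 x0\<close>, which is therefore
  \<open>v\<close>.\<close>

lemma bij_betw_cyclic_label:
  assumes "cyclic_on \<sigma> V" "card V = v" "x0 \<in> V"
  shows "bij_betw (cyclic_label \<sigma> x0) (Zmod v) V"
    and "t \<in> Zmod v \<Longrightarrow> cyclic_label \<sigma> x0 ((t + 1) mod int v) = \<sigma> (cyclic_label \<sigma> x0 t)"
proof -
  have V: "V = orbit \<sigma> x0" using assms by (auto simp: cyclic_on_alldef)
  then have x0: "x0 \<in> orbit \<sigma> x0" using assms by simp
  define m where "m = funpow_dist1 \<sigma> x0 x0"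
  have inj: "inj_on (\<lambda>n. (\<sigma> ^^ n) x0) {0..<m}" and img: "V = (\<lambda>n. (\<sigma> ^^ n) x0) ` {0..<m}"
    using inj_on_funpow_dist1[OF x0] orbit_conv_funpow_dist1[OF x0] V by (auto simp: m_def)
  have m: "m = v" using card_image[OF inj] img assms(2) by simp
  have "bij_betw nat (Zmod v) {0..<v}"
    by (rule bij_betwI[where g = int]) (auto simp: Zmod_def)
  moreover have "bij_betw (\<lambda>n. (\<sigma> ^^ n) x0) {0..<v} V"
    using inj img m by (simp add: bij_betw_def)
  ultimately show "bij_betw (cyclic_label \<sigma> x0) (Zmod v) V"
    using bij_betw_trans by (fastforce simp: cyclic_label_def[abs_def] comp_def)
  show "cyclic_label \<sigma> x0 ((t + 1) mod int v) = \<sigma> (cyclic_label \<sigma> x0 t)" if "t \<in> Zmod v"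
  proof (cases "t + 1 = int v")
    case True
    then have "v = Suc (nat t)" using that by (auto simp: Zmod_def)
    \<comment> \<open>The wrap from \<open>v - 1\<close> to \<open>0\<close> closes up because
      \<open>v\<close> is the return time.\<close>
    moreover have "(\<sigma> ^^ v) x0 = x0" using funpow_dist1_prop[OF x0] m unfolding m_def by argo
    moreover have "(t + 1) mod int v = 0" using True by simp
    ultimately show ?thesis unfolding cyclic_label_def by simp
  next
    case False
    then have "(t + 1) mod int v = t + 1" "nat (t + 1) = Suc (nat t)"
      using that by (auto simp: Zmod_def)
    then show ?thesis by (simp add: cyclic_label_def)
  qed
qed

text \<open>A block with at least two points contains a pair of distinct points, and the number of
  blocks through that pair, counted with multiplicity, is one.\<close>

lemma design_lambda_1_eq_mset_set:
  assumes "is_design v k 1 V B" "2 \<le> k"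
  shows "B = mset_set (set_mset B)"
proof (rule multiset_eqI)
  fix b
  show "count B b = count (mset_set (set_mset B)) b"
  proof (cases "b \<in># B")
    case True
    then have b: "b \<subseteq> V" "card b = k" using assms by (auto simp: is_design_def)
    then have "\<not> is_singleton b" "b \<noteq> {}" using \<open>2 \<le> k\<close> by (auto simp: is_singleton_altdef)
    then obtain x y where xy: "x \<in> b" "y \<in> b" "x \<noteq> y"
      by (metis insertI1 is_singletonI' ex_in_conv)
    have "count B b = count {#b \<in># B. x \<in> b \<and> y \<in> b#} b" using xy by simp
    also have "\<dots> \<le> size {#b \<in># B. x \<in> b \<and> y \<in> b#}" by (rule count_le_size)
    also have "\<dots> = 1"
      using assms(1) b(1) xy unfolding is_design_def by (meson subsetD)
    finally show ?thesis using True by (simp add: Suc_le_eq[symmetric] le_antisym)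
  qed (simp add: not_in_iff)
qed

theorem theorem1:
  fixes p k :: nat
    and V :: "'a set"
    and B :: "'a set multiset"
    and \<sigma> :: "'a \<Rightarrow> 'a"
    and x0 :: 'a
  assumes "2 \<le> k"
    and "prime p"
    and "k < p"
    and "cyclic_design_by p k 1 V B \<sigma>"
    and "x0 \<in> V"
  shows "\<exists>F. is_DDF p k 1 F \<and>
             B = image_mset (\<lambda>b. cyclic_label \<sigma> x0 ` b) (generated_blocks p F)"
proof -
  have design: "is_design p k 1 V B" and auto: "image_mset (\<lambda>b. \<sigma> ` b) B = B"
    and cyc: "cyclic_on \<sigma> V" and "card V = p"
    using assms(4) by (auto simp: cyclic_design_by_def design_automorphism_def is_design_def)
  define lab where "lab = cyclic_label \<sigma> x0"
  have bij: "bij_betw lab (Zmod p) V"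
    and step: "\<And>t. t \<in> Zmod p \<Longrightarrow> lab ((t + 1) mod int p) = \<sigma> (lab t)"
    using bij_betw_cyclic_label[OF cyc \<open>card V = p\<close> assms(5)] by (simp_all add: lab_def)
  have inj: "inj_on lab (Zmod p)" and img: "lab ` Zmod p = V"
    using bij by (auto simp: bij_betw_def)
  \<comment> \<open>The blocks pulled back along the labelling to \<open>Zmod p\<close>.\<close>
  define D where "D = {b. b \<subseteq> Zmod p \<and> lab ` b \<in># B}"
  have one: "\<exists>c. {#b \<in># B. x \<in> b \<and> y \<in> b#} = {#c#}" if "x \<in> V" "y \<in> V" "x \<noteq> y" for x y
    using design that by (intro size_1_singleton_mset) (auto simp: is_design_def)
  have mem: "x \<in> b \<longleftrightarrow> lab x \<in> lab ` b" if "b \<subseteq> Zmod p" "x \<in> Zmod p" for x b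
    using inj_on_image_mem_iff[OF inj that(2,1)] by simp
  interpret cyclic_linear_space p k D
  proof
    show "prime p" "2 \<le> k" "k < p" by fact+
  next
    fix b assume "b \<in> D"
    then show sub: "b \<subseteq> Zmod p" by (simp add: D_def)
    have "card (lab ` b) = k" using \<open>b \<in> D\<close> design by (auto simp: D_def is_design_def)
    then show "card b = k" using card_image[OF inj_on_subset[OF inj sub]] by simp
    \<comment> \<open>\<open>lab\<close> carries translation by \<open>1\<close> to
      \<open>\<sigma>\<close>, so invariance of \<open>B\<close> under \<open>\<sigma>\<close>
      becomes \<open>translate_1\<close>.\<close>
    have "lab ` translate p b 1 = \<sigma> ` lab ` b"
      using step sub by (force simp: translate_def image_image)
    moreover have "\<sigma> ` lab ` b \<in># image_mset (\<lambda>b. \<sigma> ` b) B"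
      using \<open>b \<in> D\<close> by (simp add: D_def)
    ultimately show "translate p b 1 \<in> D"
      using auto translate_subset_Zmod[of p b 1] \<open>k < p\<close> by (simp add: D_def)
  next
    fix x y assume xy: "x \<in> Zmod p" "y \<in> Zmod p" "x \<noteq> y"
    then obtain c where "{#b \<in># B. lab x \<in> b \<and> lab y \<in> b#} = {#c#}"
      using one[of "lab x" "lab y"] inj img by (auto simp: inj_on_eq_iff)
    then have c: "c \<in># B" "lab x \<in> c" "lab y \<in> c"
      by (metis (mono_tags, lifting) mem_Collect_eq set_mset_filter union_single_eq_member
          add_mset_add_single empty_neutral(1))+
    then have "c \<subseteq> lab ` Zmod p" using design img by (auto simp: is_design_def)
    then obtain b where "b \<subseteq> Zmod p" "c = lab ` b" by (meson subset_image_iff)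
    then show "\<exists>b\<in>D. x \<in> b \<and> y \<in> b" using c xy mem by (auto simp: D_def)
  next
    fix b b' x y
    assume *: "b \<in> D" "b' \<in> D" "x \<noteq> y" "x \<in> b" "y \<in> b" "x \<in> b'" "y \<in> b'"
    then have sub: "b \<subseteq> Zmod p" "b' \<subseteq> Zmod p" and "lab ` b \<in># B" "lab ` b' \<in># B"
      by (auto simp: D_def)
    have "x \<in> Zmod p" "y \<in> Zmod p" using * sub by auto
    then obtain c where c: "{#b \<in># B. lab x \<in> b \<and> lab y \<in> b#} = {#c#}"
      using one[of "lab x" "lab y"] inj img \<open>x \<noteq> y\<close> by (auto simp: inj_on_eq_iff)
    have "lab ` b \<in># {#b \<in># B. lab x \<in> b \<and> lab y \<in> b#}"
      "lab ` b' \<in># {#b \<in># B. lab x \<in> b \<and> lab y \<in> b#}"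
      using * \<open>lab ` b \<in># B\<close> \<open>lab ` b' \<in># B\<close> by simp_all
    then have "lab ` b = lab ` b'" unfolding c by simp
    then show "b = b'" using inj_on_image_eq_iff[OF inj sub] by simp
  qed
  obtain F where F: "is_DDF p k 1 F" "generated_blocks p F = mset_set D"
    using ex_DDF by blast
  \<comment> \<open>Different pulled-back blocks have different images, so mapping
    \<open>mset_set D\<close> forward gives every block of \<open>B\<close> once, which is
    \<open>B\<close> itself.\<close>
  have "inj_on ((`) lab) D"
    using inj_on_image_eq_iff[OF inj] by (intro inj_onI) (auto simp: D_def)
  moreover have "(`) lab ` D = set_mset B"
  proof (intro equalityI subsetI)
    fix c assume c: "c \<in># B"
    then have "c \<subseteq> lab ` Zmod p" using design img by (auto simp: is_design_def)
    then obtain b where "b \<subseteq> Zmod p" "c = lab ` b" by (meson subset_image_iff)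
    then show "c \<in> (`) lab ` D" using c by (auto simp: D_def)
  qed (auto simp: D_def)
  ultimately have "image_mset ((`) lab) (mset_set D) = B"
    using design_lambda_1_eq_mset_set[OF design assms(1)] by (simp add: image_mset_mset_set)
  then show ?thesis using F by (auto simp: lab_def)
qed

end
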